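(* Let $A$ be a coherent quantale. The function $t_A:\mathrm{Spec}(\mathrm{Vir}(A))\to \mathrm{Sp}(A)$, $t_A(p)=\bigvee\{e\in B(A): e\le p\}$, is surjective and continuous.
   Context: A quantale is a complete lattice $(A,\vee,\wedge,0,1)$ with an associative multiplication distributing over arbitrary joins in each variable. All quantales are assumed commutative and integral ($1$ is the multiplicative unit). $K(A)$ is the set of compact elements. $A$ is algebraic if every element is a join of compact elements; $A$ is coherent if it is algebraic, $1\in K(A)$ and $K(A)$ is closed under multiplication. $a^{\perp}=\bigvee\{x\in A: ax=0\}$. An element $a\in A$ is pure if for all $c\in K(A)$, $c\le a$ implies $a\vee c^{\perp}=1$. The set $\mathrm{Vir}(A)$ of pure elements, with the joins and finite meets of $A$, is a frame. $\mathrm{Spec}(\mathrm{Vir}(A))$ is the set of prime elements of this frame ($p\in\mathrm{Vir}(A)$, $p<1$, and $a\wedge b\le p$ implies $a\le p$ or $b\le p$ for $a,b\in \mathrm{Vir}(A)$), topologized by the open sets $\{p: a\not\le p\}$, $a\in \mathrm{Vir}(A)$. $B(A)$ is the Boolean algebra of complemented elements of $A$ (those $e$ with $e\vee e^{\perp}=1$). An element of $A$ is regular if it is a join of complemented elements. A max-regular element is a maximal element of the set of regular elements different from $1$. The Pierce spectrum $\mathrm{Sp}(A)$ is the set of max-regular elements, with the topology having the sets $U(e)=\{q\in \mathrm{Sp}(A): e\not\le q\}$, $e\in B(A)$, as a basis of open sets. For $p\in\mathrm{Spec}(\mathrm{Vir}(A))$ the element $t_A(p)$ is max-regular, so that $t_A$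 is well defined. *)

theory Defs
  imports "HOL-Analysis.Abstract_Topology"
begin

text \<open>Commutative integral quantales. The bounds \<open>0\<close> and \<open>1\<close> of the lattice are \<open>bot\<close> and \<open>top\<close>;
  integrality identifies \<open>top\<close> with the multiplicative unit. Distributivity in the other
  variable follows by commutativity, and the case \<open>B = {}\<close> gives \<open>a * bot = bot\<close>.\<close>

class quantale = complete_lattice + comm_monoid_mult +
  assumes mult_Sup: "a * Sup B = Sup ((\<lambda>b. a * b) ` B)"
    and one_eq_top: "1 = top"
begin

definition compact_elements :: "'a set" where
  "compact_elements = {c. \<forall>S. c \<le> Sup S \<longrightarrow> (\<exists>F\<subseteq>S. finite F \<and> c \<le> Sup F)}"

definition perp :: "'a \<Rightarrow> 'a" where
  "perp a = Sup {x. a * x = bot}"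

definition pure :: "'a \<Rightarrow> bool" where
  "pure a \<longleftrightarrow> (\<forall>c\<in>compact_elements. c \<le> a \<longrightarrow> sup a (perp c) = 1)"

definition Vir :: "'a set" where
  "Vir = {a. pure a}"

text \<open>Binary meets of the frame \<open>Vir\<close> are those of the quantale; see \<open>Vir_inf\<close> and \<open>Vir_Sup\<close>.\<close>

definition Spec_Vir :: "'a set" where
  "Spec_Vir = {p\<in>Vir. p < 1 \<and> (\<forall>a\<in>Vir. \<forall>b\<in>Vir. inf a b \<le> p \<longrightarrow> a \<le> p \<or> b \<le> p)}"

text \<open>The constant \<open>topology\<close> is meaningful only on families satisfying \<open>istopology\<close>; for the two
  topologies below this is part of the proofs of \<open>openin_Spec_Vir_topology\<close> (where coherence
  is used) and \<open>openin_Sp_topology\<close>.\<close>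

definition Spec_Vir_topology :: "'a topology" where
  "Spec_Vir_topology = topology (\<lambda>U. \<exists>a\<in>Vir. U = {p\<in>Spec_Vir. \<not> a \<le> p})"

definition complemented_elements :: "'a set" where
  "complemented_elements = {e. sup e (perp e) = 1}"

definition regular :: "'a \<Rightarrow> bool" where
  "regular a \<longleftrightarrow> (\<exists>S\<subseteq>complemented_elements. a = Sup S)"

definition max_regular :: "'a \<Rightarrow> bool" where
  "max_regular q \<longleftrightarrow> regular q \<and> q \<noteq> 1 \<and> (\<forall>r. regular r \<and> r \<noteq> 1 \<and> q \<le> r \<longrightarrow> r = q)"

definition Sp :: "'a set" where
  "Sp = {q. max_regular q}"

definition Sp_basic_open :: "'a \<Rightarrow> 'a set" where
  "Sp_basic_open e = {q\<in>Sp. \<not> e \<le> q}"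

definition Sp_topology :: "'a topology" where
  "Sp_topology = topology (arbitrary union_of (\<lambda>U. \<exists>e\<in>complemented_elements. U = Sp_basic_open e))"

definition t_map :: "'a \<Rightarrow> 'a" where
  "t_map p = Sup {e\<in>complemented_elements. e \<le> p}"

lemma mult_sup: "a * sup b c = sup (a * b) (a * c)"
  using mult_Sup[of a "{b, c}"] by simp

lemma mult_bot: "a * bot = bot"
  using mult_Sup[of a "{}"] by simp

lemma mult_mono_right: "b \<le> c \<Longrightarrow> a * b \<le> a * c"
  by (metis mult_sup sup.absorb_iff2 sup.cobounded1)

lemma mult_le_left: "a * b \<le> a"
  by (metis mult_mono_right mult_1_right one_eq_top top_greatest)

lemma mult_le_right: "a * b \<le> b"
  using mult_le_left[of b a] by (simp add: mult.commute)

lemma mult_perp: "a * perp a = bot"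
proof -
  have "a * perp a \<le> bot"
    unfolding perp_def mult_Sup by (rule SUP_least) simp
  then show ?thesis by (simp add: bot_unique)
qed

lemma le_perp_iff: "x \<le> perp a \<longleftrightarrow> a * x = bot"
proof
  assume "x \<le> perp a"
  then show "a * x = bot"
    using mult_mono_right[of x "perp a" a] by (simp add: mult_perp bot_unique)
next
  assume "a * x = bot"
  then show "x \<le> perp a" unfolding perp_def by (intro Sup_upper) simp
qed

lemma perp_antimono: "a \<le> b \<Longrightarrow> perp b \<le> perp a"
  by (metis le_perp_iff mult_mono_right mult.commute bot_unique mult_perp)

lemma sup_mult_eq_1:
  assumes "sup x z = 1" "sup y z = 1"
  shows "sup (x * y) z = 1"
proof -
  have "1 = sup x z * sup y z" using assms by simp
  also have "\<dots> = sup (sup x z * y) (sup x z * z)" by (rule mult_sup)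
  also have "\<dots> \<le> sup (x * y) z"
  proof (rule sup_least)
    have "sup x z * y = sup (x * y) (z * y)"
      using mult_sup[of y x z] by (simp add: mult.commute)
    also have "\<dots> \<le> sup (x * y) z"
      using mult_le_left[of z y] by (simp add: le_supI2)
    finally show "sup x z * y \<le> sup (x * y) z" .
    show "sup x z * z \<le> sup (x * y) z"
      using mult_le_right[of "sup x z" z] by (simp add: le_supI2)
  qed
  finally show ?thesis using one_eq_top top_unique by simp
qed

lemma sup_eq_1_mono: "sup x y = 1 \<Longrightarrow> x \<le> x' \<Longrightarrow> y \<le> y' \<Longrightarrow> sup x' y' = 1"
  by (metis one_eq_top sup_mono top_unique)

lemma complemented_mult:
  assumes "e \<in> complemented_elements" "f \<in> complemented_elements"
  shows "e * f \<in> complemented_elements"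
proof -
  have "perp e \<le> perp (e * f)" "perp f \<le> perp (e * f)"
    by (intro perp_antimono mult_le_left mult_le_right)+
  then show ?thesis
    using assms sup_eq_1_mono[OF _ order_refl] sup_mult_eq_1
    unfolding complemented_elements_def by blast
qed

lemma regular_sup:
  assumes "regular q" "e \<in> complemented_elements"
  shows "regular (sup e q)"
proof -
  obtain S where "S \<subseteq> complemented_elements" "q = Sup S"
    using assms(1) unfolding regular_def by blast
  then have "insert e S \<subseteq> complemented_elements" "sup e q = Sup (insert e S)"
    using assms(2) by auto
  then show ?thesis unfolding regular_def by blast
qed

lemma max_regular_prime:
  assumes q: "max_regular q" and ef: "e \<in> complemented_elements" "f \<in> complemented_elements"
    and le: "e * f \<le> q"
  shows "e \<le> q \<or> f \<le> q"
proof (rule ccontr)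
  assume not: "\<not> (e \<le> q \<or> f \<le> q)"
  have 1: "sup g q = 1" if "g \<in> complemented_elements" "\<not> g \<le> q" for g
    using q regular_sup[of q g] that unfolding max_regular_def
    by (metis sup.cobounded1 sup.cobounded2)
  have "sup (e * f) q = 1" by (rule sup_mult_eq_1) (use 1 ef not in auto)
  then show False using le q unfolding max_regular_def by (simp add: sup_absorb2)
qed

lemma Sp_basic_open_Int:
  assumes "e \<in> complemented_elements" "f \<in> complemented_elements"
  shows "Sp_basic_open e \<inter> Sp_basic_open f = Sp_basic_open (e * f)"
  unfolding Sp_basic_open_def Sp_def
  using max_regular_prime[OF _ assms] mult_le_left[of e f] mult_le_right[of e f]
  by (auto intro: order_trans)

lemma openin_Sp_topology:
  "openin Sp_topology =
     arbitrary union_of (\<lambda>U. \<exists>e\<in>complemented_elements. U = Sp_basic_open e)"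
  unfolding Sp_topology_def
proof (rule topology_inverse', rule istopology_base)
  fix S T
  assume "\<exists>e\<in>complemented_elements. S = Sp_basic_open e"
    "\<exists>e\<in>complemented_elements. T = Sp_basic_open e"
  then show "\<exists>e\<in>complemented_elements. S \<inter> T = Sp_basic_open e"
    using Sp_basic_open_Int complemented_mult by metis
qed

lemma topspace_Sp_topology: "topspace Sp_topology = Sp"
proof
  show "topspace Sp_topology \<subseteq> Sp"
    using openin_topspace[of Sp_topology]
    unfolding openin_Sp_topology union_of_def Sp_basic_open_def by auto
  have "Sp_basic_open 1 = Sp"
    unfolding Sp_basic_open_def Sp_def max_regular_def by (auto simp: one_eq_top top_unique)
  moreover have "1 \<in> complemented_elements"
    unfolding complemented_elements_def by (simp add: one_eq_top)
  ultimately have "openin Sp_topology Sp"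
    unfolding openin_Sp_topology by (intro arbitrary_union_of_inc) auto
  then show "Sp \<subseteq> topspace Sp_topology" by (rule openin_subset)
qed

end

class coherent_quantale = quantale +
  assumes algebraic: "\<exists>S\<subseteq>compact_elements. a = Sup S"
    and one_compact: "1 \<in> compact_elements"
    and compact_mult: "c \<in> compact_elements \<Longrightarrow> d \<in> compact_elements \<Longrightarrow> c * d \<in> compact_elements"
begin

lemma Vir_inf:
  assumes "a \<in> Vir" "b \<in> Vir"
  shows "inf a b \<in> Vir"
  unfolding Vir_def pure_def
proof (clarify)
  fix c assume "c \<in> compact_elements" "c \<le> inf a b"
  then have "sup a (perp c) = 1" "sup b (perp c) = 1"
    using assms unfolding Vir_def pure_def by auto
  then have "sup (a * b) (perp c) = 1" by (rule sup_mult_eq_1)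
  moreover have "a * b \<le> inf a b" by (intro inf_greatest mult_le_left mult_le_right)
  ultimately show "sup (inf a b) (perp c) = 1" using sup_eq_1_mono by blast
qed

lemma Vir_Sup:
  assumes "S \<subseteq> Vir"
  shows "Sup S \<in> Vir"
  unfolding Vir_def pure_def
proof (clarify)
  fix c assume c: "c \<in> compact_elements" "c \<le> Sup S"
  define K where "K = {k\<in>compact_elements. \<exists>s\<in>S. k \<le> s}"
  have "s \<le> Sup K" if "s \<in> S" for s
  proof -
    obtain T where "T \<subseteq> compact_elements" "s = Sup T" using algebraic by blast
    then have "T \<subseteq> K" using that Sup_upper unfolding K_def by blast
    then show ?thesis using \<open>s = Sup T\<close> Sup_subset_mono by blast
  qed
  then have "c \<le> Sup K" using c(2) Sup_least order_trans by blast
  then obtain F where F: "F \<subseteq> K" "finite F" "c \<le> Sup F"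
    using c(1) unfolding compact_elements_def by blast
  have "sup (Sup S) (perp (Sup F)) = 1"
    using F(2,1)
  proof (induction F)
    case empty
    have "perp bot = top" using le_perp_iff[of top bot] mult_bot[of top]
      by (simp add: mult.commute top_unique)
    then show ?case by (simp add: one_eq_top)
  next
    case (insert k F)
    then obtain s where s: "s \<in> S" "k \<le> s" "k \<in> compact_elements"
      unfolding K_def by blast
    then have "sup s (perp k) = 1" using assms unfolding Vir_def pure_def by blast
    then have 1: "sup (perp k) (Sup S) = 1"
      using sup_eq_1_mono[of s "perp k" "Sup S" "perp k"] Sup_upper[OF s(1)]
      by (simp add: sup_commute)
    have 2: "sup (perp (Sup F)) (Sup S) = 1"
      using insert by (simp add: sup_commute)
    have "sup k (Sup F) * (perp k * perp (Sup F)) = bot"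
    proof -
      have "(perp k * perp (Sup F)) * k = bot"
        by (metis mult.assoc mult.commute mult_perp mult_bot)
      moreover have "(perp k * perp (Sup F)) * Sup F = bot"
        by (metis mult.assoc mult.commute mult_perp mult_bot)
      ultimately show ?thesis
        using mult_sup[of "perp k * perp (Sup F)" k "Sup F"] by (simp add: mult.commute)
    qed
    then have "perp k * perp (Sup F) \<le> perp (Sup (insert k F))"
      by (simp add: le_perp_iff)
    then show ?case using sup_mult_eq_1[OF 1 2] sup_eq_1_mono by (metis sup_commute order_refl)
  qed
  then show "sup (Sup S) (perp c) = 1"
    using perp_antimono[OF F(3)] sup_eq_1_mono by blast
qed

lemma openin_Spec_Vir_topology:
  "openin Spec_Vir_topology U \<longleftrightarrow> (\<exists>a\<in>Vir. U = {p\<in>Spec_Vir. \<not> a \<le> p})"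
proof -
  let ?D = "\<lambda>a. {p\<in>Spec_Vir. \<not> a \<le> p}"
  have "istopology (\<lambda>U. \<exists>a\<in>Vir. U = ?D a)"
    unfolding istopology_def
  proof (intro conjI allI impI)
    fix S T assume "\<exists>a\<in>Vir. S = ?D a" "\<exists>a\<in>Vir. T = ?D a"
    then obtain a b where ab: "a \<in> Vir" "b \<in> Vir" "S = ?D a" "T = ?D b" by blast
    have "S \<inter> T = ?D (inf a b)"
      using ab unfolding Spec_Vir_def by (auto intro: le_infI1 le_infI2)
    then show "\<exists>a\<in>Vir. S \<inter> T = ?D a" using Vir_inf ab by blast
  next
    fix \<K> assume "\<forall>K\<in>\<K>. \<exists>a\<in>Vir. K = ?D a"
    then obtain g where g: "\<And>K. K \<in> \<K> \<Longrightarrow> g K \<in> Vir \<and> K = ?D (g K)" by metis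
    have "\<Union>\<K> = ?D (Sup (g ` \<K>))"
    proof (rule set_eqI)
      fix p
      have "p \<in> \<Union>\<K> \<longleftrightarrow> (\<exists>K\<in>\<K>. p \<in> ?D (g K))" using g by blast
      then show "p \<in> \<Union>\<K> \<longleftrightarrow> p \<in> ?D (Sup (g ` \<K>))" by (auto simp: SUP_le_iff)
    qed
    moreover have "Sup (g ` \<K>) \<in> Vir" using g by (intro Vir_Sup) blast
    ultimately show "\<exists>a\<in>Vir. \<Union>\<K> = ?D a" by blast
  qed
  then show ?thesis unfolding Spec_Vir_topology_def by (simp add: topology_inverse')
qed

lemma topspace_Spec_Vir_topology: "topspace Spec_Vir_topology = Spec_Vir"
proof
  show "topspace Spec_Vir_topology \<subseteq> Spec_Vir"
    using openin_topspace[of Spec_Vir_topology] unfolding openin_Spec_Vir_topology by blast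
  have "1 \<in> Vir" unfolding Vir_def pure_def by (simp add: one_eq_top)
  moreover have "Spec_Vir = {p\<in>Spec_Vir. \<not> 1 \<le> p}"
    unfolding Spec_Vir_def using less_le_not_le by blast
  ultimately have "openin Spec_Vir_topology Spec_Vir"
    unfolding openin_Spec_Vir_topology by blast
  then show "Spec_Vir \<subseteq> topspace Spec_Vir_topology" by (rule openin_subset)
qed

end

end

theory Submission imports Defs begin

text \<open>If \<open>e\<close> is complemented, then \<open>e\<close> and \<open>e\<^sup>\<bottom>\<close> are pure with meet \<open>0\<close>, so a prime \<open>p\<close> of \<open>Vir(A)\<close>
  lies above one of them; this makes \<open>t(p)\<close> max-regular. Conversely a max-regular \<open>q\<close> is
  pure, and since \<open>1\<close> is compact it lies below a maximal proper pure element \<open>p\<close>, which is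
  prime; then \<open>q \<le> t(p)\<close>, and maximality of \<open>q\<close> gives equality. Finally \<open>e \<le> t(p)\<close> iff \<open>e \<le> p\<close> for
  complemented \<open>e\<close>, so the preimage of \<open>U(e)\<close> is the open set of \<open>Spec(Vir(A))\<close> given by \<open>e\<close>.\<close>

text \<open>Since \<open>perp\<close> is antitone, \<open>c \<le> e\<close> gives
  \<open>perp e \<le> perp c\<close>, so \<open>sup e (perp c)\<close> lies above
  \<open>sup e (perp e)\<close>, which is \<open>1\<close>.\<close>

lemma complemented_in_Vir:
  fixes e :: "'a::quantale"
  assumes "e \<in> complemented_elements"
  shows "e \<in> Vir"
  unfolding Vir_def pure_def
proof (clarify)
  fix c assume "c \<le> e"
  then show "sup e (perp c) = 1"
    using assms sup_eq_1_mono[of e "perp e" e "perp c"] perp_antimono[of c e]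
    unfolding complemented_elements_def by simp
qed

lemma perp_complemented:
  fixes e :: "'a::quantale"
  assumes "e \<in> complemented_elements"
  shows "perp e \<in> complemented_elements"
proof -
  have "e \<le> perp (perp e)"
    by (simp add: le_perp_iff mult.commute[of "perp e"] mult_perp)
  then show ?thesis
    using assms sup_eq_1_mono[of "perp e" e "perp e" "perp (perp e)"]
    unfolding complemented_elements_def by (simp add: sup_commute)
qed

text \<open>Both \<open>e\<close> and \<open>perp e\<close> annihilate the meet, hence so does their
  join, which is the unit.\<close>

lemma inf_perp_eq_bot:
  fixes e :: "'a::quantale"
  assumes "e \<in> complemented_elements"
  shows "inf e (perp e) = bot"
proof -
  let ?x = "inf e (perp e)"
  have "e * ?x \<le> e * perp e" by (rule mult_mono_right) simp
  then have "?x * e = bot" by (simp add: mult_perp mult.commute bot_unique)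
  moreover have "perp e * ?x \<le> perp e * e" by (rule mult_mono_right) simp
  then have "?x * perp e = bot" by (metis mult_perp mult.commute bot_unique)
  ultimately have "?x * sup e (perp e) = bot" by (simp add: mult_sup)
  then show ?thesis using assms unfolding complemented_elements_def by simp
qed

lemma regular_t_map: "regular (t_map (p::'a::quantale))"
  unfolding regular_def t_map_def
  by (intro exI[of _ "{e \<in> complemented_elements. e \<le> p}"]) simp

lemma t_map_le: "t_map (p::'a::quantale) \<le> p"
  unfolding t_map_def by (rule Sup_least) simp

lemma complemented_le_t_map_iff:
  fixes p :: "'a::quantale"
  assumes "e \<in> complemented_elements"
  shows "e \<le> t_map p \<longleftrightarrow> e \<le> p"
proof
  show "e \<le> p" if "e \<le> t_map p" using that t_map_le by (rule order_trans)
  show "e \<le> t_map p" if "e \<le> p" unfolding t_map_def using that assms by (intro Sup_upper) simp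
qed

text \<open>With \<open>regular_t_map\<close> and \<open>t_map_le\<close>, this makes
  \<open>t_map p\<close> the largest regular element below \<open>p\<close>.\<close>

lemma regular_le_t_map:
  fixes p :: "'a::quantale"
  assumes "regular q" "q \<le> p"
  shows "q \<le> t_map p"
proof -
  obtain S where S: "S \<subseteq> complemented_elements" "q = Sup S"
    using assms(1) unfolding regular_def by blast
  have "e \<le> t_map p" if "e \<in> S" for e
    using that S assms(2) complemented_le_t_map_iff[of e p] by (meson Sup_le_iff subsetD)
  then show ?thesis using S by (simp add: Sup_least)
qed

lemma complemented_or_perp_le_prime:
  fixes p :: "'a::quantale"
  assumes "p \<in> Spec_Vir" "e \<in> complemented_elements"
  shows "e \<le> p \<or> perp e \<le> p"
proof -
  have "inf e (perp e) \<le> p" using inf_perp_eq_bot[OF assms(2)] by simp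
  then show ?thesis
    using assms complemented_in_Vir perp_complemented unfolding Spec_Vir_def by blast
qed

lemma t_map_ne_1:
  fixes p :: "'a::quantale"
  assumes "p \<in> Spec_Vir"
  shows "t_map p \<noteq> 1"
  using assms t_map_le[of p] unfolding Spec_Vir_def by (auto simp: less_le_not_le)

lemma t_map_in_Sp:
  fixes p :: "'a::quantale"
  assumes p: "p \<in> Spec_Vir"
  shows "t_map p \<in> Sp"
proof -
  have "r = t_map p" if r: "regular r" "r \<noteq> 1" "t_map p \<le> r" for r
  proof -
    obtain S where S: "S \<subseteq> complemented_elements" "r = Sup S"
      using r(1) unfolding regular_def by blast
    have "e \<le> t_map p" if "e \<in> S" for e
    proof -
      have e: "e \<in> complemented_elements" "e \<le> r" using that S by (auto intro: Sup_upper)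
      \<comment> \<open>Otherwise \<open>r\<close> would lie above both \<open>e\<close> and
        \<open>perp e\<close>, hence above their join \<open>1\<close>.\<close>
      have "\<not> perp e \<le> r"
      proof
        assume "perp e \<le> r"
        then have "sup r r = 1"
          using e sup_eq_1_mono unfolding complemented_elements_def by blast
        then show False using r(2) by simp
      qed
      \<comment> \<open>A complemented element below \<open>p\<close> is below
        \<open>t_map p\<close>, hence below \<open>r\<close>.\<close>
      then have "\<not> perp e \<le> p"
        using complemented_le_t_map_iff[OF perp_complemented[OF e(1)]] r(3) order_trans by blast
      then show ?thesis
        using complemented_or_perp_le_prime[OF p e(1)] complemented_le_t_map_iff[OF e(1)] by blast
    qed
    then show ?thesis using S r(3) by (simp add: Sup_least antisym)
  qed
  then show ?thesis
    using regular_t_map t_map_ne_1[OF p] unfolding Sp_def max_regular_def by blast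
qed

lemma regular_in_Vir:
  fixes q :: "'a::coherent_quantale"
  assumes "regular q"
  shows "q \<in> Vir"
  using assms complemented_in_Vir Vir_Sup unfolding regular_def by blast

lemma Vir_sup:
  fixes a :: "'a::coherent_quantale"
  assumes "a \<in> Vir" "b \<in> Vir"
  shows "sup a b \<in> Vir"
  using Vir_Sup[of "{a, b}"] assms by simp

text \<open>If the join were \<open>1\<close>, compactness of \<open>1\<close> would give a finite
  subset of \<open>C\<close> with join \<open>1\<close>; by induction, a single member of the chain
  bounds that subset, and this member would be \<open>1\<close>.\<close>

lemma Sup_chain_ne_1:
  fixes C :: "'a::coherent_quantale set"
  assumes "C \<noteq> {}" "1 \<notin> C" and chain: "\<And>x y. x \<in> C \<Longrightarrow> y \<in> C \<Longrightarrow> x \<le> y \<or> y \<le> x"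
  shows "Sup C \<noteq> 1"
proof
  assume "Sup C = 1"
  then have "1 \<le> Sup C" by simp
  then obtain F where F: "F \<subseteq> C" "finite F" "1 \<le> Sup F"
    using one_compact unfolding compact_elements_def by blast
  have "\<exists>c\<in>C. Sup F \<le> c"
    using F(2,1)
  proof (induction F)
    case empty
    then show ?case using assms(1) by auto
  next
    case (insert x F)
    then obtain c where "c \<in> C" "Sup F \<le> c" by auto
    then show ?case using chain[of x c] insert.prems by (auto intro: order_trans)
  qed
  then show False using F(3) assms(2) by (metis one_eq_top top_unique)
qed

text \<open>If neither \<open>a\<close> nor \<open>b\<close> is below \<open>m\<close>, maximality
  makes both comaximal with \<open>m\<close>. Comaximality passes to the product
  \<open>a * b\<close>, which lies below \<open>inf a b\<close> and so below \<open>m\<close>,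
  forcing \<open>m = 1\<close>.\<close>

lemma maximal_in_Spec_Vir:
  fixes m :: "'a::coherent_quantale"
  assumes m: "m \<in> Vir" "m \<noteq> 1"
    and max: "\<And>a. a \<in> Vir \<Longrightarrow> a \<noteq> 1 \<Longrightarrow> m \<le> a \<Longrightarrow> a = m"
  shows "m \<in> Spec_Vir"
proof -
  have "m < 1" using m(2) by (simp add: one_eq_top top.not_eq_extremum)
  moreover have "a \<le> m \<or> b \<le> m" if ab: "a \<in> Vir" "b \<in> Vir" "inf a b \<le> m" for a b
  proof (rule ccontr)
    assume not: "\<not> (a \<le> m \<or> b \<le> m)"
    have "sup x m = 1" if "x \<in> Vir" "\<not> x \<le> m" for x
      using max[of "sup x m"] Vir_sup[OF that(1) m(1)] that(2) by (metis sup.cobounded1 sup.cobounded2)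
    then have "sup (a * b) m = 1" using ab not by (intro sup_mult_eq_1) auto
    moreover have "a * b \<le> m"
      using ab(3) mult_le_left mult_le_right by (meson inf_greatest order_trans)
    ultimately show False using m(2) by (simp add: sup_absorb2)
  qed
  ultimately show ?thesis using m(1) unfolding Spec_Vir_def by blast
qed

lemma exists_Spec_Vir_above:
  fixes q :: "'a::coherent_quantale"
  assumes "q \<in> Vir" "q \<noteq> 1"
  shows "\<exists>p\<in>Spec_Vir. q \<le> p"
proof -
  define A where "A = {a \<in> Vir. a \<noteq> 1 \<and> q \<le> a}"
  have "\<exists>m\<in>A. \<forall>a\<in>A. m \<le> a \<longrightarrow> a = m"
  proof (rule predicate_Zorn)
    show "partial_order_on A (relation_of (\<le>) A)"
      by (rule partial_order_on_relation_ofI) auto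
  next
    fix C assume C: "C \<in> Chains (relation_of (\<le>) A)"
    have CA: "C \<subseteq> A" using C by (rule Chains_relation_of)
    show "\<exists>u\<in>A. \<forall>a\<in>C. a \<le> u"
    proof (cases "C = {}")
      case True
      \<comment> \<open>The empty chain is bounded by \<open>q\<close> itself; its join
        \<open>bot\<close> need not lie above \<open>q\<close>.\<close>
      then show ?thesis using assms unfolding A_def by auto
    next
      case False
      have "Sup C \<noteq> 1"
        using False CA C by (intro Sup_chain_ne_1) (auto simp: A_def Chains_def relation_of_def)
      moreover have "Sup C \<in> Vir" using CA by (intro Vir_Sup) (auto simp: A_def)
      moreover have "q \<le> Sup C"
        using False CA unfolding A_def by (auto intro: Sup_upper2)
      ultimately show ?thesis unfolding A_def by (auto intro: Sup_upper)
    qed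
  qed
  then obtain m where m: "m \<in> A" "\<And>a. a \<in> A \<Longrightarrow> m \<le> a \<Longrightarrow> a = m" by blast
  have "m \<in> Spec_Vir"
    using m order_trans unfolding A_def by (intro maximal_in_Spec_Vir) blast+
  then show ?thesis using m(1) unfolding A_def by blast
qed

lemma t_map_image: "t_map ` (Spec_Vir :: 'a::coherent_quantale set) = Sp"
proof
  show "t_map ` (Spec_Vir :: 'a set) \<subseteq> Sp" using t_map_in_Sp by blast
  show "(Sp :: 'a set) \<subseteq> t_map ` Spec_Vir"
  proof
    fix q :: 'a assume "q \<in> Sp"
    then have q: "regular q" "q \<noteq> 1" "\<And>r. regular r \<Longrightarrow> r \<noteq> 1 \<Longrightarrow> q \<le> r \<Longrightarrow> r = q"
      unfolding Sp_def max_regular_def by auto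
    obtain p where p: "p \<in> Spec_Vir" "q \<le> p"
      using exists_Spec_Vir_above regular_in_Vir q by blast
    \<comment> \<open>\<open>t_map p\<close> is a proper regular element above \<open>q\<close>, so
      maximality of \<open>q\<close> applies to it.\<close>
    have "t_map p = q"
      using q(3) regular_t_map t_map_ne_1[OF p(1)] regular_le_t_map[OF q(1) p(2)] by blast
    then show "q \<in> t_map ` Spec_Vir" using p(1) by blast
  qed
qed

lemma continuous_map_t_map:
  "continuous_map (Spec_Vir_topology :: 'a::coherent_quantale topology) Sp_topology t_map"
proof (rule continuous_map_into_topology_base[OF openin_Sp_topology],
    unfold topspace_Spec_Vir_topology topspace_Sp_topology)
  show "t_map p \<in> Sp" if "p \<in> Spec_Vir" for p :: 'a
    using that by (rule t_map_in_Sp)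
next
  fix U :: "'a set"
  assume "\<exists>e\<in>complemented_elements. U = Sp_basic_open e"
  then obtain e where e: "e \<in> complemented_elements" "U = Sp_basic_open e" by blast
  \<comment> \<open>\<open>t_map_in_Sp\<close> settles the membership in \<open>Sp\<close> that is
    built into \<open>U\<close>, leaving only \<open>\<not> e \<le> t_map p\<close>.\<close>
  have "{p \<in> Spec_Vir. t_map p \<in> U} = {p \<in> Spec_Vir. \<not> e \<le> p}"
    using t_map_in_Sp complemented_le_t_map_iff[OF e(1)] unfolding e(2) Sp_basic_open_def by blast
  then show "openin Spec_Vir_topology {p \<in> Spec_Vir. t_map p \<in> U}"
    using complemented_in_Vir[OF e(1)] unfolding openin_Spec_Vir_topology by blast
qed

theorem proposition5p3:
  shows "t_map ` (Spec_Vir :: 'a::coherent_quantale set) = Sp \<and>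
         continuous_map (Spec_Vir_topology :: 'a topology) Sp_topology t_map"
  using t_map_image continuous_map_t_map by blast

end
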